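(* Fix $t>0$, $x_0\in\mathbb{R}$, $\mu\in\mathbb{R}$ and $\theta>0$. For $\sigma^2>0$ let $\gamma_{\sigma^2}$ be the Gaussian probability measure on $\mathbb{R}$ with mean $m_t=x_0e^{-\theta t}+\mu(1-e^{-\theta t})$ and variance $\sigma_t^2=\frac{\sigma^2}{2\theta}\left(1-e^{-2\theta t}\right)$. For $n\in\mathbb{N}$, $n\ge 1$, define $T_n^{***}:\mathbb{R}^n\to\mathbb{R}$ by $$T_n^{***}(z_1,\dots,z_n)=\frac{2\theta\sum_{k=1}^n\left(z_k-x_0e^{-\theta t}-\mu(1-e^{-\theta t})\right)^2}{n\left(1-e^{-2\theta t}\right)}.$$ Then for every $\sigma^2>0$, $$\gamma_{\sigma^2}^{\infty}\left(\left\{(z_k)_{k\in\mathbb{N}}\in\mathbb{R}^{\infty}:\ \lim_{n\to\infty}T_n^{***}(z_1,\dots,z_n)=\sigma^2\right\}\right)=1,$$ that is, $T_n^{***}$ is a consistent estimator of the parameter $\sigma^2>0$, in the sense of convergence almost everywhere, for the family $(\gamma_{\sigma^2}^{\infty})_{\sigma^2>0}$.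
   Context: $\mathbb{R}^\infty=\mathbb{R}^{\mathbb{N}}$ is the space of real sequences $(z_k)_{k\in\mathbb{N}}$, $\mathbb{N}=\{1,2,\dots\}$, with its product Borel $\sigma$-algebra; for a Borel probability measure $\gamma$ on $\mathbb{R}$, $\gamma^{\infty}$ denotes the infinite product measure $\gamma\times\gamma\times\cdots$ on $\mathbb{R}^\infty$. Given a family $(\gamma_\vartheta)_{\vartheta\in\Theta}$ of Borel probability measures on $\mathbb{R}$ with $\Theta\subseteq\mathbb{R}$, a sequence of Borel measurable functions $T_n:\mathbb{R}^n\to\mathbb{R}$ is called a consistent estimator of the parameter $\vartheta$ in the sense of convergence almost everywhere for the family $(\gamma_\vartheta^\infty)_{\vartheta\in\Theta}$ if $\gamma_\vartheta^\infty(\{(z_k)_{k\in\mathbb{N}}:\lim_{n\to\infty}T_n(z_1,\dots,z_n)=\vartheta\})=1$ for each $\vartheta\in\Theta$. (The measure $\gamma_{\sigma^2}$ is the law at time $t$ of the Ornstein-Uhlenbeck process $x_t=x_0e^{-\theta t}+\mu(1-e^{-\theta t})+\sigma\int_0^te^{-\theta(t-s)}dW_s$ with $\sigma=\sqrt{\sigma^2}$ and $W$ a Wiener process; the claim only uses $\gamma_{\sigma^2}$ as defined in it.) *)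

theory Defs
  imports "HOL-Probability.Probability"
begin

(* Coordinates are numbered from 1: real sequences are the elements of {1..} \<rightarrow>\<^sub>E UNIV
   and R^n is {1..n} \<rightarrow>\<^sub>E UNIV, i.e. the spaces of the respective product measures. *)

definition infinite_power :: "real measure \<Rightarrow> (nat \<Rightarrow> real) measure" where
  "infinite_power \<gamma> = (\<Pi>\<^sub>M k\<in>{1::nat..}. \<gamma>)"

(* T n is a function on R^n; its value at an index n = 0 is irrelevant. *)

definition consistent_estimator ::
  "real set \<Rightarrow> (real \<Rightarrow> real measure) \<Rightarrow> (nat \<Rightarrow> (nat \<Rightarrow> real) \<Rightarrow> real) \<Rightarrow> bool" where
  "consistent_estimator \<Theta> \<gamma> T \<longleftrightarrow>
     (\<forall>\<theta>\<in>\<Theta>. prob_space (\<gamma> \<theta>) \<and> sets (\<gamma> \<theta>) = sets borel) \<and>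
     (\<forall>n\<ge>1. T n \<in> borel_measurable (\<Pi>\<^sub>M k\<in>{1..n}. (borel :: real measure))) \<and>
     (\<forall>\<theta>\<in>\<Theta>. emeasure (infinite_power (\<gamma> \<theta>))
        {z \<in> space (infinite_power (\<gamma> \<theta>)).
           (\<lambda>n. T n (restrict z {1..n})) \<longlonglongrightarrow> \<theta>} = 1)"

definition gaussian :: "real \<Rightarrow> real \<Rightarrow> real measure" where
  "gaussian m v = density lborel (\<lambda>x. ennreal (normal_density m (sqrt v) x))"

definition OU_mean :: "real \<Rightarrow> real \<Rightarrow> real \<Rightarrow> real \<Rightarrow> real" where
  "OU_mean t x0 \<mu> \<theta> = x0 * exp (- \<theta> * t) + \<mu> * (1 - exp (- \<theta> * t))"

(* The last argument s2 is the squared diffusion coefficient sigma^2, not sigma. *)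

definition OU_variance :: "real \<Rightarrow> real \<Rightarrow> real \<Rightarrow> real" where
  "OU_variance t \<theta> s2 = s2 / (2 * \<theta>) * (1 - exp (- 2 * \<theta> * t))"

definition OU_law :: "real \<Rightarrow> real \<Rightarrow> real \<Rightarrow> real \<Rightarrow> real \<Rightarrow> real measure" where
  "OU_law t x0 \<mu> \<theta> s2 = gaussian (OU_mean t x0 \<mu> \<theta>) (OU_variance t \<theta> s2)"

definition OU_estimator ::
  "real \<Rightarrow> real \<Rightarrow> real \<Rightarrow> real \<Rightarrow> nat \<Rightarrow> (nat \<Rightarrow> real) \<Rightarrow> real" where
  "OU_estimator t x0 \<mu> \<theta> n z =
     2 * \<theta> * (\<Sum>k=1..n. (z k - x0 * exp (- \<theta> * t) - \<mu> * (1 - exp (- \<theta> * t)))\<^sup>2) /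
       (real n * (1 - exp (- 2 * \<theta> * t)))"

end

theory Submission
  imports Defs "HOL-Real_Asymp.Real_Asymp"
begin

text \<open>
  The estimator is, up to the factor \<open>2\<theta> / (1 - exp (-2\<theta>t))\<close>, the average of the squared centred
  coordinates, so the claim is a strong law of large numbers for nonnegative independent variables
  with uniformly bounded variance. Along the squares \<open>n = k\<^sup>2\<close> the second moments of the centred
  averages are \<open>O(k\<^sup>-\<^sup>2)\<close>, hence summable, which forces almost sure convergence there; as the partial
  sums are monotone and \<open>(k + 1)\<^sup>2 / k\<^sup>2\<close> tends to 1, convergence extends to all \<open>n\<close>.
\<close>

section \<open>Strong law of large numbers for nonnegative variables\<close>

text \<open>With \<open>r n\<close> the integer part of \<open>sqrt n\<close>, monotonicity squeezes
  \<open>S n / n\<close> between the averages at the two neighbouring squares, each multiplied by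
  the ratio of that square to \<open>n\<close>.\<close>

lemma incseq_average_tendsto_of_squares:
  fixes S :: "nat \<Rightarrow> real"
  assumes "incseq S" and lim: "(\<lambda>k. S (k\<^sup>2) / real (k\<^sup>2)) \<longlonglongrightarrow> c"
  shows "(\<lambda>n. S n / real n) \<longlonglongrightarrow> c"
proof -
  define r where "r n = nat \<lfloor>sqrt (real n)\<rfloor>" for n
  have r: "(r n)\<^sup>2 \<le> n" "n \<le> (Suc (r n))\<^sup>2" for n
  proof -
    have *: "real (r n) \<le> sqrt (real n)" "sqrt (real n) \<le> real (Suc (r n))"
      unfolding r_def by (simp, linarith)
    have "real (r n)^2 \<le> real n" "real n \<le> real (Suc (r n))^2"
      using power_mono[OF *(1), of 2] power_mono[OF *(2), of 2] by simp_all
    then show "(r n)\<^sup>2 \<le> n" "n \<le> (Suc (r n))\<^sup>2"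
      by (simp_all only: of_nat_power[symmetric] of_nat_le_iff)
  qed
  have flt: "filterlim r at_top sequentially"
    unfolding r_def by real_asymp
  \<comment> \<open>\<open>r n\<close> differs from \<open>sqrt n\<close> by less than 1, so both
    ratios are 1 up to an error of order \<open>1 / sqrt n\<close>.\<close>
  have q: "(\<lambda>n. real ((r n)\<^sup>2) / real n) \<longlonglongrightarrow> 1" "(\<lambda>n. real ((Suc (r n))\<^sup>2) / real n) \<longlonglongrightarrow> 1"
    unfolding r_def of_nat_power Suc_eq_plus1 by real_asymp+
  \<comment> \<open>If \<open>r n = 0\<close>, the lower bound below collapses to 0 through division
    by zero instead of cancelling to \<open>S ((r n)\<^sup>2) / n\<close>.\<close>
  have r_pos: "\<forall>\<^sub>F n in sequentially. r n > 0 \<and> n > 0"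
    using eventually_compose_filterlim[OF eventually_gt_at_top flt]
    by (intro eventually_conj eventually_gt_at_top)
  show ?thesis
  proof (rule tendsto_sandwich)
    show "(\<lambda>n. S ((r n)\<^sup>2) / real ((r n)\<^sup>2) * (real ((r n)\<^sup>2) / real n)) \<longlonglongrightarrow> c"
      using tendsto_mult[OF filterlim_compose[OF lim flt] q(1)] by simp
    show "(\<lambda>n. S ((Suc (r n))\<^sup>2) / real ((Suc (r n))\<^sup>2) * (real ((Suc (r n))\<^sup>2) / real n)) \<longlonglongrightarrow> c"
      using tendsto_mult[OF filterlim_compose[OF lim filterlim_compose[OF filterlim_Suc flt]] q(2)]
      by simp
    show "\<forall>\<^sub>F n in sequentially.
        S ((r n)\<^sup>2) / real ((r n)\<^sup>2) * (real ((r n)\<^sup>2) / real n) \<le> S n / real n"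
      using r_pos
      by eventually_elim (use incseqD[OF \<open>incseq S\<close> r(1)] in \<open>auto simp: divide_right_mono\<close>)
    show "\<forall>\<^sub>F n in sequentially.
        S n / real n \<le> S ((Suc (r n))\<^sup>2) / real ((Suc (r n))\<^sup>2) * (real ((Suc (r n))\<^sup>2) / real n)"
      using r_pos
      by eventually_elim (use incseqD[OF \<open>incseq S\<close> r(2)] in
          \<open>auto simp: divide_right_mono simp del: of_nat_Suc of_nat_power\<close>)
  qed
qed

text \<open>Expanding the square one variable at a time, each cross term is a product of
  expectations, because \<open>Z a\<close> is independent of the sum of the others, and the factor
  \<open>expectation (Z a)\<close> is 0.\<close>

lemma (in prob_space) indep_vars_second_moment_sum:
  fixes Z :: "'i \<Rightarrow> 'a \<Rightarrow> real"
  assumes "finite I" and "indep_vars (\<lambda>_. borel) Z I"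
    and "\<And>i. i \<in> I \<Longrightarrow> integrable M (\<lambda>\<omega>. (Z i \<omega>)\<^sup>2)"
    and "\<And>i. i \<in> I \<Longrightarrow> expectation (Z i) = 0"
  shows "integrable M (\<lambda>\<omega>. (\<Sum>i\<in>I. Z i \<omega>)\<^sup>2)"
    and "expectation (\<lambda>\<omega>. (\<Sum>i\<in>I. Z i \<omega>)\<^sup>2) = (\<Sum>i\<in>I. expectation (\<lambda>\<omega>. (Z i \<omega>)\<^sup>2))"
proof -
  have "integrable M (\<lambda>\<omega>. (\<Sum>i\<in>I. Z i \<omega>)\<^sup>2) \<and>
    expectation (\<lambda>\<omega>. (\<Sum>i\<in>I. Z i \<omega>)\<^sup>2) = (\<Sum>i\<in>I. expectation (\<lambda>\<omega>. (Z i \<omega>)\<^sup>2))"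
    using assms
  proof (induction I rule: finite_induct)
    case empty
    then show ?case by simp
  next
    case (insert a I)
    have rv: "Z i \<in> borel_measurable M" if "i \<in> insert a I" for i
      using insert.prems(1) that unfolding indep_vars_def by blast
    have Z: "integrable M (Z i)" if "i \<in> insert a I" for i
      using square_integrable_imp_integrable[OF rv insert.prems(2)] that by blast
    have IH: "integrable M (\<lambda>\<omega>. (\<Sum>i\<in>I. Z i \<omega>)\<^sup>2)"
      "expectation (\<lambda>\<omega>. (\<Sum>i\<in>I. Z i \<omega>)\<^sup>2) = (\<Sum>i\<in>I. expectation (\<lambda>\<omega>. (Z i \<omega>)\<^sup>2))"
      using insert.IH[OF indep_vars_subset[OF insert.prems(1)]] insert.prems(2,3) by auto
    have ind: "indep_var borel (Z a) borel (\<lambda>\<omega>. \<Sum>i\<in>I. Z i \<omega>)"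
      using insert by (intro indep_vars_sum) auto
    have S: "integrable M (\<lambda>\<omega>. \<Sum>i\<in>I. Z i \<omega>)"
      using Z by auto
    have cross: "integrable M (\<lambda>\<omega>. Z a \<omega> * (\<Sum>i\<in>I. Z i \<omega>))"
      "expectation (\<lambda>\<omega>. Z a \<omega> * (\<Sum>i\<in>I. Z i \<omega>)) = 0"
      using indep_var_integrable[OF ind Z S] indep_var_lebesgue_integral[OF ind Z S]
        insert.prems(3) by auto
    have eq: "(\<Sum>i\<in>insert a I. Z i \<omega>)\<^sup>2 =
        (Z a \<omega>)\<^sup>2 + (\<Sum>i\<in>I. Z i \<omega>)\<^sup>2 + 2 * (Z a \<omega> * (\<Sum>i\<in>I. Z i \<omega>))" for \<omega>
      using insert.hyps by (simp add: power2_sum mult.assoc)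
    show ?case
      unfolding eq using insert.hyps insert.prems(2) IH cross by auto
  qed
  then show "integrable M (\<lambda>\<omega>. (\<Sum>i\<in>I. Z i \<omega>)\<^sup>2)"
    and "expectation (\<lambda>\<omega>. (\<Sum>i\<in>I. Z i \<omega>)\<^sup>2) = (\<Sum>i\<in>I. expectation (\<lambda>\<omega>. (Z i \<omega>)\<^sup>2))"
    by blast+
qed

text \<open>Summation and integration commute for nonnegative functions, so the pointwise series has
  a finite integral. It is therefore finite almost everywhere, and the terms of a convergent series
  tend to 0. This stands in for a Chebyshev and Borel-Cantelli argument.\<close>

lemma AE_tendsto_0_of_summable_integral:
  fixes f :: "nat \<Rightarrow> 'a \<Rightarrow> real"
  assumes int: "\<And>n. integrable M (f n)" and nonneg: "\<And>n x. 0 \<le> f n x"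
    and sum: "summable (\<lambda>n. integral\<^sup>L M (f n))"
  shows "AE x in M. (\<lambda>n. f n x) \<longlonglongrightarrow> 0"
proof -
  have [measurable]: "f n \<in> borel_measurable M" for n
    using int by blast
  have "(\<integral>\<^sup>+x. (\<Sum>n. ennreal (f n x)) \<partial>M) = (\<Sum>n. \<integral>\<^sup>+x. ennreal (f n x) \<partial>M)"
    by (rule nn_integral_suminf) simp
  also have "\<dots> = (\<Sum>n. ennreal (integral\<^sup>L M (f n)))"
    using int nonneg by (simp add: nn_integral_eq_integral)
  also have "\<dots> \<noteq> \<infinity>"
    using sum nonneg by (simp add: suminf_ennreal2 integral_nonneg)
  finally have "AE x in M. (\<Sum>n. ennreal (f n x)) \<noteq> \<infinity>"
    by (intro nn_integral_PInf_AE) auto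
  then show ?thesis
  proof eventually_elim
    case (elim x)
    then show ?case
      using summable_suminf_not_top[of "\<lambda>n. f n x"] nonneg by (simp add: summable_LIMSEQ_zero)
  qed
qed

text \<open>The variables are centred for the moment bound along the squares, but the interpolation
  to all \<open>n\<close> returns to \<open>X\<close> itself: nonnegativity is what makes its
  partial sums increasing.\<close>

theorem (in prob_space) strong_law_nonneg_bounded_variance:
  fixes X :: "nat \<Rightarrow> 'a \<Rightarrow> real"
  assumes ind: "indep_vars (\<lambda>_. borel) X {1..}"
    and nonneg: "\<And>i \<omega>. i \<ge> 1 \<Longrightarrow> 0 \<le> X i \<omega>"
    and sq: "\<And>i. i \<ge> 1 \<Longrightarrow> integrable M (\<lambda>\<omega>. (X i \<omega>)\<^sup>2)"
    and mean: "\<And>i. i \<ge> 1 \<Longrightarrow> expectation (X i) = c"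
    and var: "\<And>i. i \<ge> 1 \<Longrightarrow> variance (X i) \<le> v"
  shows "AE \<omega> in M. (\<lambda>n. (\<Sum>i=1..n. X i \<omega>) / real n) \<longlonglongrightarrow> c"
proof -
  define Z where "Z i \<omega> = X i \<omega> - c" for i \<omega>
  have rv: "X i \<in> borel_measurable M" if "i \<ge> 1" for i
    using ind that unfolding indep_vars_def by auto
  have X: "integrable M (X i)" if "i \<ge> 1" for i
    using square_integrable_imp_integrable[OF rv sq] that by blast
  have indZ: "indep_vars (\<lambda>_. borel) Z {1..n}" for n
    unfolding Z_def
    by (rule indep_vars_compose2[OF indep_vars_subset[OF ind]]) auto
  have Z2: "integrable M (\<lambda>\<omega>. (Z i \<omega>)\<^sup>2)" if "i \<ge> 1" for i
    unfolding Z_def power2_diff using that sq X by auto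
  have Z0: "expectation (Z i) = 0" if "i \<ge> 1" for i
    unfolding Z_def using that X mean by (simp add: prob_space)
  have Zv: "expectation (\<lambda>\<omega>. (Z i \<omega>)\<^sup>2) \<le> v" if "i \<ge> 1" for i
    using var[OF that] mean[OF that] by (simp add: Z_def)
  have mom: "integrable M (\<lambda>\<omega>. (\<Sum>i=1..n. Z i \<omega>)\<^sup>2)"
    "expectation (\<lambda>\<omega>. (\<Sum>i=1..n. Z i \<omega>)\<^sup>2) \<le> real n * v" for n
    using indep_vars_second_moment_sum[OF _ indZ, of n] Z2 Z0
      sum_bounded_above[of "{1..n}" "\<lambda>i. expectation (\<lambda>\<omega>. (Z i \<omega>)\<^sup>2)" v] Zv by auto
  \<comment> \<open>The shift to \<open>Suc k\<close> keeps the denominator nonzero. For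
    \<open>N = (Suc k)\<^sup>2\<close> the second moment is at most
    \<open>N * v / N\<^sup>2 = v / N\<close>, which is summable in \<open>k\<close>.\<close>
  define f where "f k \<omega> = ((\<Sum>i=1..(Suc k)\<^sup>2. Z i \<omega>) / real ((Suc k)\<^sup>2))\<^sup>2" for k \<omega>
  have fint: "integrable M (f k)" for k
    unfolding f_def power_divide using mom(1) by (intro integrable_divide)
  have flim: "AE \<omega> in M. (\<lambda>k. f k \<omega>) \<longlonglongrightarrow> 0"
  proof (rule AE_tendsto_0_of_summable_integral[OF fint])
    have le: "expectation (f k) \<le> v * inverse (real (Suc k) ^ 2)" for k
    proof -
      have "expectation (f k) \<le> (real ((Suc k)\<^sup>2) * v) / (real ((Suc k)\<^sup>2))\<^sup>2"
        unfolding f_def power_divide integral_divide_zero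
        by (intro divide_right_mono mom(2)) simp
      also have "\<dots> = v * inverse (real (Suc k) ^ 2)"
        by (simp only: of_nat_power) (simp add: power2_eq_square divide_simps del: of_nat_Suc)
      finally show ?thesis .
    qed
    have "summable (\<lambda>k. v * inverse (real (Suc k) ^ 2))"
      using inverse_power_summable[of 2, where 'a=real] 
      by (intro summable_mult) (subst summable_Suc_iff, simp)
    then show "summable (\<lambda>k. expectation (f k))"
      by (rule summable_comparison_test[rotated])
        (use le in \<open>auto simp: f_def abs_of_nonneg integral_nonneg simp del: of_nat_Suc\<close>)
  qed (simp add: f_def)
  then show ?thesis
  proof eventually_elim
    case (elim \<omega>)
    have "(\<lambda>k. sqrt (f k \<omega>)) \<longlonglongrightarrow> 0"
      using tendsto_real_sqrt[OF elim] by simp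
    then have "(\<lambda>k. (\<Sum>i=1..(Suc k)\<^sup>2. Z i \<omega>) / real ((Suc k)\<^sup>2)) \<longlonglongrightarrow> 0"
      unfolding f_def real_sqrt_abs by (rule tendsto_rabs_zero_cancel)
    moreover have "(\<Sum>i=1..(Suc k)\<^sup>2. Z i \<omega>) / real ((Suc k)\<^sup>2) =
        (\<Sum>i=1..(Suc k)\<^sup>2. X i \<omega>) / real ((Suc k)\<^sup>2) - c" for k
      by (simp add: Z_def sum_subtractf diff_divide_distrib del: of_nat_Suc of_nat_power)
    ultimately have "(\<lambda>k. (\<Sum>i=1..(Suc k)\<^sup>2. X i \<omega>) / real ((Suc k)\<^sup>2)) \<longlonglongrightarrow> c"
      by (simp only: LIM_zero_iff)
    \<comment> \<open>The shift is undone here; the extra term at \<open>k = 0\<close> does not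
      affect the limit.\<close>
    then have "(\<lambda>k. (\<Sum>i=1..k\<^sup>2. X i \<omega>) / real (k\<^sup>2)) \<longlonglongrightarrow> c"
      by (rule LIMSEQ_imp_Suc)
    moreover have "incseq (\<lambda>n. \<Sum>i=1..n. X i \<omega>)"
      by (rule incseq_SucI) (simp add: nonneg)
    ultimately show ?case
      by (intro incseq_average_tendsto_of_squares)
  qed
qed

section \<open>Coordinates of product measures and Gaussian moments\<close>

text \<open>Independence means that the joint law is the product of the marginals. Here the joint
  map is the identity on the product space, and the marginal of coordinate \<open>i\<close> is
  \<open>N i\<close>.\<close>

lemma indep_vars_PiM_coordinates:
  assumes "I \<noteq> {}" and "\<And>i. i \<in> I \<Longrightarrow> prob_space (N i)"
  shows "prob_space.indep_vars (PiM I N) N (\<lambda>i \<omega>. \<omega> i) I"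
proof -
  interpret prob_space "PiM I N"
    by (rule prob_space_PiM) (rule assms(2))
  have "distr (PiM I N) (PiM I N) (\<lambda>\<omega>. \<lambda>i\<in>I. \<omega> i) = distr (PiM I N) (PiM I N) (\<lambda>\<omega>. \<omega>)"
    by (rule distr_cong) (auto simp: space_PiM PiE_def extensional_restrict)
  also have "\<dots> = (\<Pi>\<^sub>M i\<in>I. distr (PiM I N) (N i) (\<lambda>\<omega>. \<omega> i))"
    using assms(2) by (simp add: distr_PiM_component cong: PiM_cong)
  finally show ?thesis
    using assms(1) by (subst indep_vars_iff_distr_eq_PiM') auto
qed

lemma prob_space_gaussian: "v > 0 \<Longrightarrow> prob_space (gaussian m v)"
  unfolding gaussian_def by (rule prob_space_normal_density) simp

lemma sets_gaussian [measurable_cong, simp]: "sets (gaussian m v) = sets borel"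
  by (simp add: gaussian_def)

text \<open>Used for \<open>k = 1\<close>, where the value is \<open>v\<close>, and for
  \<open>k = 2\<close>, where it is \<open>3 * v\<^sup>2\<close>.\<close>

lemma gaussian_even_moment:
  assumes "v > 0"
  shows "has_bochner_integral (gaussian m v) (\<lambda>x. (x - m) ^ (2 * k))
    (fact (2 * k) / ((2 / v) ^ k * fact k))"
  unfolding gaussian_def
  using normal_moment_even[of "sqrt v" m k] assms
  by (intro has_bochner_integral_density) auto

lemma gaussian_power_average_square:
  assumes "v > 0"
  shows "AE z in infinite_power (gaussian m v).
    (\<lambda>n. (\<Sum>k=1..n. (z k - m)\<^sup>2) / real n) \<longlonglongrightarrow> v"
proof -
  let ?G = "gaussian m v" and ?P = "infinite_power (gaussian m v)"
  interpret G: prob_space ?G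
    by (rule prob_space_gaussian) fact
  interpret P: prob_space ?P
    unfolding infinite_power_def by (rule prob_space_PiM) (rule G.prob_space_axioms)
  \<comment> \<open>Each coordinate with index at least 1 has law \<open>?G\<close>, so
    one-dimensional moments carry over to the product space.\<close>
  have transfer: "has_bochner_integral ?P (\<lambda>z. g (z i)) x"
    if "has_bochner_integral ?G g x" "i \<ge> 1" for g :: "real \<Rightarrow> real" and x i
  proof -
    have D: "distr ?P ?G (\<lambda>z. z i) = ?G"
      unfolding infinite_power_def using that(2)
      by (intro distr_PiM_component) (auto intro: G.prob_space_axioms)
    have coord: "(\<lambda>z. z i) \<in> measurable ?P ?G"
      unfolding infinite_power_def using that(2) by simp
    have g: "g \<in> borel_measurable ?G"
      using that(1) by (rule borel_measurable_has_bochner_integral)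
    show ?thesis
      using that(1)
      unfolding has_bochner_integral_iff integrable_distr_eq[OF coord g, unfolded D]
        integral_distr[OF coord g, unfolded D] .
  qed
  have m2: "has_bochner_integral ?P (\<lambda>z. (z i - m)\<^sup>2) v" if "i \<ge> 1" for i
    using transfer[OF gaussian_even_moment[OF assms, of m 1] that] assms by simp
  have m4: "has_bochner_integral ?P (\<lambda>z. ((z i - m)\<^sup>2)\<^sup>2) (3 * v\<^sup>2)" if "i \<ge> 1" for i
    using transfer[OF gaussian_even_moment[OF assms, of m 2] that] assms
    by (simp add: fact_numeral power2_eq_square power4_eq_xxxx mult.assoc)
  show ?thesis
  proof (rule P.strong_law_nonneg_bounded_variance)
    have "P.indep_vars (\<lambda>_. ?G) (\<lambda>i z. z i) {1..}"
      unfolding infinite_power_def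
      by (rule indep_vars_PiM_coordinates) (auto intro: G.prob_space_axioms)
    then show "P.indep_vars (\<lambda>_. borel) (\<lambda>i z. (z i - m)\<^sup>2) {1..}"
      by (rule P.indep_vars_compose2[where Y = "\<lambda>_ x. (x - m)\<^sup>2"]) simp
    fix i :: nat assume i: "i \<ge> 1"
    note I = m2[OF i] m4[OF i]
    show "integrable ?P (\<lambda>z. ((z i - m)\<^sup>2)\<^sup>2)" "P.expectation (\<lambda>z. (z i - m)\<^sup>2) = v"
      using I by (auto simp: has_bochner_integral_iff)
    \<comment> \<open>The variance of the squared deviation is its second moment minus its squared
      mean, \<open>3 * v\<^sup>2 - v\<^sup>2\<close>.\<close>
    then show "P.variance (\<lambda>z. (z i - m)\<^sup>2) \<le> 2 * v\<^sup>2"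
      using I by (subst P.variance_eq) (auto simp: has_bochner_integral_iff)
  qed simp
qed

section \<open>Consistency of the estimator\<close>

lemma OU_estimator_restrict:
  "OU_estimator t x0 \<mu> \<theta> n (restrict z {1..n}) =
    2 * \<theta> / (1 - exp (- 2 * \<theta> * t)) * ((\<Sum>k=1..n. (z k - OU_mean t x0 \<mu> \<theta>)\<^sup>2) / real n)"
proof -
  have "(\<Sum>k=1..n. (restrict z {1..n} k - x0 * exp (- \<theta> * t) - \<mu> * (1 - exp (- \<theta> * t)))\<^sup>2) =
      (\<Sum>k=1..n. (z k - OU_mean t x0 \<mu> \<theta>)\<^sup>2)"
    by (intro sum.cong) (auto simp: OU_mean_def diff_diff_eq)
  then show ?thesis
    by (simp add: OU_estimator_def mult.commute)
qed

theorem lemma3p4p1: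
  fixes t x0 \<mu> \<theta> :: real
  assumes "t > 0" and "\<theta> > 0"
  shows "(\<forall>s2>0. emeasure (infinite_power (OU_law t x0 \<mu> \<theta> s2))
            {z \<in> space (infinite_power (OU_law t x0 \<mu> \<theta> s2)).
               (\<lambda>n. OU_estimator t x0 \<mu> \<theta> n (restrict z {1..n})) \<longlonglongrightarrow> s2} = 1) \<and>
         consistent_estimator {0<..} (OU_law t x0 \<mu> \<theta>) (OU_estimator t x0 \<mu> \<theta>)"
proof -
  define d where "d = 1 - exp (- 2 * \<theta> * t)"
  have d: "d > 0"
    using assms by (simp add: d_def)
  have var_pos: "OU_variance t \<theta> s2 > 0" if "s2 > 0" for s2
    using that assms d by (simp add: OU_variance_def d_def)
  have prob: "prob_space (OU_law t x0 \<mu> \<theta> s2)" if "s2 > 0" for s2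
    unfolding OU_law_def by (rule prob_space_gaussian) (rule var_pos[OF that])
  have meas: "OU_estimator t x0 \<mu> \<theta> n \<in> borel_measurable (\<Pi>\<^sub>M k\<in>{1..n}. borel)" for n
    unfolding OU_estimator_def by measurable
  have main: "emeasure (infinite_power (OU_law t x0 \<mu> \<theta> s2))
      {z \<in> space (infinite_power (OU_law t x0 \<mu> \<theta> s2)).
        (\<lambda>n. OU_estimator t x0 \<mu> \<theta> n (restrict z {1..n})) \<longlonglongrightarrow> s2} = 1" if s2: "s2 > 0" for s2
  proof -
    let ?P = "infinite_power (OU_law t x0 \<mu> \<theta> s2)"
    interpret P: prob_space ?P
      unfolding infinite_power_def by (rule prob_space_PiM) (rule prob[OF s2])
    have [measurable]: "(\<lambda>z. OU_estimator t x0 \<mu> \<theta> n (restrict z {1..n})) \<in> borel_measurable ?P" for n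
      unfolding infinite_power_def OU_law_def
      by (rule measurable_compose[OF measurable_restrict meas]) simp
    have lim: "AE z in ?P. (\<lambda>n. OU_estimator t x0 \<mu> \<theta> n (restrict z {1..n})) \<longlonglongrightarrow> s2"
      using gaussian_power_average_square[OF var_pos[OF s2], of "OU_mean t x0 \<mu> \<theta>"]
      unfolding OU_law_def[symmetric]
    proof eventually_elim
      case (elim z)
      \<comment> \<open>The normalising factor of the estimator is the reciprocal of the factor
        \<open>d / (2 * \<theta>)\<close> by which \<open>OU_variance\<close> scales
        \<open>s2\<close>, so the limit of the averages is turned back into
        \<open>s2\<close>.\<close>
      have "2 * \<theta> / d * OU_variance t \<theta> s2 = s2"
        using assms d unfolding OU_variance_def d_def[symmetric] by simp
      then show ?case
        unfolding OU_estimator_restrict d_def[symmetric]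
        using tendsto_mult_left[OF elim, of "2 * \<theta> / d"] by simp
    qed
    show ?thesis
      proof (rule P.emeasure_eq_1_AE)
      \<comment> \<open>Passing from almost everywhere to measure 1 requires the convergence set to
        be measurable, which follows from measurability of the estimator for every
        \<open>n\<close>.\<close>
      show "{z \<in> space ?P. (\<lambda>n. OU_estimator t x0 \<mu> \<theta> n (restrict z {1..n})) \<longlonglongrightarrow> s2} \<in> sets ?P"
        unfolding pred_def[symmetric] by (rule measurable_limit) measurable
      show "AE z in ?P. z \<in> {z \<in> space ?P. (\<lambda>n. OU_estimator t x0 \<mu> \<theta> n (restrict z {1..n})) \<longlonglongrightarrow> s2}"
        using AE_space lim by eventually_elim (rule CollectI, rule conjI)
    qed
  qed
  show ?thesis
    unfolding consistent_estimator_def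
    using main prob meas by (auto simp: OU_law_def)
qed

end
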